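(* Consider the mixing of two ideal $N$-particle gases initially confined at the same temperature $T$ in two equal halves of a box, where the partition is removed and the gases expand to the entire box. Let $\lambda_{\rm S}$ be the singular probability of the mixing process. From the Jarzynski-type equality $\langle e^{-\beta(W-\Delta F)}\rangle=1-\lambda_{\rm S}$ and the fact that the work vanishes ($W=0$) in the mixing process, one has $\Delta F=k_{\rm B}T\ln(1-\lambda_{\rm S})$, and thus the thermodynamic entropy production of the mixing is $$\Delta S=-k_{\rm B}\ln(1-\lambda_{\rm S}).$$ Moreover: (i) if the two gases are identical, $\lambda_{\rm S}^{\rm id}=1-\binom{2N}{N}2^{-2N}$ and $$\Delta S^{\rm id}=2Nk_{\rm B}\ln2-k_{\rm B}\ln\binom{2N}{N},$$ which for sufficiently large $N$ is approximated as $$\Delta S^{\rm id}\simeq\tfrac12k_{\rm B}\ln(\pi N);$$ since this value is sub-extensive, $\Delta S^{\rm id}=0$ in the thermodynamic limit; (ii) if the two gases are of different kinds, $\lambda_{\rm S}^{\rm dif}=1-2^{-2N}$ and $$\Delta S^{\rm dif}=2Nk_{\rm B}\ln2.$$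
   Context: $k_{\rm B}$ is the Boltzmann constant and $\beta=1/(k_{\rm B}T)$. $W$ is the work performed on the system, $\Delta F$ the free-energy difference between the final and initial configurations, and $\langle\cdot\rangle$ the average over the forward (mixing) process. The equality $\langle e^{-\beta(W-\Delta F)}\rangle=1-\lambda_{\rm S}$ is the generalization of the Jarzynski equality valid for processes starting from a local equilibrium state restricted to a region of phase space, with the time-reversed process started from the equilibrium state of the whole space; $\lambda_{\rm S}$ is the total probability, in the time-reversed process, of the paths having no counterpart in the forward process (the singular part of the time-reversed path measure with respect to the forward one). The thermodynamic entropy is required to be additive. In the reverse process of the mixing, the $2N$ particles are initially at thermal equilibrium in the entire box, and the partition is then inserted in the middle; each particle of the ideal gas is found in the left or right half with probability $1/2$ independently. For identical gases, the only events with a counterpart in the forward process are those with exactly $N$ particles in the left half. For different gases, the only event with a counterpart is the one in which all $N$ particles of the kind originally in the left half are in the left half and all $N$ particles of the other kind are in the right half. *)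

theory Defs
  imports "HOL-Probability.Probability" "HOL-Library.Landau_Symbols"
begin


definition mutually_singular :: "'a measure \<Rightarrow> 'a measure \<Rightarrow> bool" where
  "mutually_singular Q P \<longleftrightarrow> sets Q = sets P \<and>
     (\<exists>A\<in>sets P. emeasure Q (space P - A) = 0 \<and> emeasure P A = 0)"

definition lebesgue_decomposition ::
    "'a measure \<Rightarrow> 'a measure \<Rightarrow> 'a measure \<Rightarrow> 'a measure \<Rightarrow> bool" where
  "lebesgue_decomposition P Q Qac Qs \<longleftrightarrow>
     sets Qac = sets Q \<and> sets Qs = sets Q \<and>
     (\<forall>A\<in>sets Q. emeasure Q A = emeasure Qac A + emeasure Qs A) \<and>
     absolutely_continuous P Qac \<and> mutually_singular Qs P"

text \<open>Total mass of the singular part of \<open>Q\<close> with respect to \<open>P\<close>. For finite measures the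
  decomposition exists and is unique, so the description denotes.\<close>

definition singular_probability :: "'a measure \<Rightarrow> 'a measure \<Rightarrow> real" where
  "singular_probability P Q =
     (THE l. \<exists>Qac Qs. lebesgue_decomposition P Q Qac Qs \<and> l = measure Qs (space Qs))"



record thermo_state =
  energy :: real
  entropy :: real

definition helmholtz :: "real \<Rightarrow> thermo_state \<Rightarrow> real" where
  "helmholtz T s = energy s - T * entropy s"

text \<open>\<open>forward\<close> is the law of the phase-space paths of the mixing process. \<open>reversed\<close> is the
  law of the time-reversed process (global equilibrium, then insertion of the partition), carried
  back to the same path space by reversing each path, so that the two can be compared.
  \<open>in_left i \<omega>\<close> says that on path \<open>\<omega>\<close> particle \<open>i\<close> is in the left half while the partition is in
  place, i.e. at the start of the forward process and at the end of the reversed one. Particles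
  are numbered \<open>0, ..., 2 N - 1\<close>; the first \<open>N\<close> of them make up the gas originally in the left
  half.\<close>

record 'p mixing =
  forward :: "'p measure"
  reversed :: "'p measure"
  work :: "'p \<Rightarrow> real"
  in_left :: "nat \<Rightarrow> 'p \<Rightarrow> bool"
  left_gas :: thermo_state
  right_gas :: thermo_state
  mixed :: thermo_state

definition singular_prob :: "'p mixing \<Rightarrow> real" where
  "singular_prob m = singular_probability (forward m) (reversed m)"

text \<open>Before the mixing the system consists of two separate gases, so by additivity its free
  energy and its entropy are the sums of those of the two gases.\<close>

definition free_energy_diff :: "real \<Rightarrow> 'p mixing \<Rightarrow> real" where
  "free_energy_diff T m =
     helmholtz T (mixed m) - (helmholtz T (left_gas m) + helmholtz T (right_gas m))"

definition entropy_production :: "'p mixing \<Rightarrow> real" where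
  "entropy_production m = entropy (mixed m) - (entropy (left_gas m) + entropy (right_gas m))"

text \<open>The energy assumption is that of ideal gases: there is no interaction energy, and the
  internal energy depends only on temperature and particle number, not on volume.\<close>

locale ideal_gas_mixing =
  fixes N :: nat and m :: "'p mixing"
  assumes N_pos: "0 < N"
    and prob_space_forward: "prob_space (forward m)"
    and prob_space_reversed: "prob_space (reversed m)"
    and sets_reversed: "sets (reversed m) = sets (forward m)"
    and work_measurable: "work m \<in> borel_measurable (forward m)"
    and independent_particles:
      "prob_space.indep_vars (reversed m) (\<lambda>_. count_space UNIV) (in_left m) {..<2 * N}"
    and half_probability:
      "\<And>i. i < 2 * N \<Longrightarrow> measure (reversed m) {\<omega> \<in> space (reversed m). in_left m i \<omega>} = 1 / 2"
    and ideal_gas_energy: "energy (mixed m) = energy (left_gas m) + energy (right_gas m)"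

definition jarzynski_equality :: "real \<Rightarrow> real \<Rightarrow> 'p mixing \<Rightarrow> bool" where
  "jarzynski_equality kB T m \<longleftrightarrow>
     (let \<beta> = 1 / (kB * T) in
       (\<integral>\<omega>. exp (- \<beta> * (work m \<omega> - free_energy_diff T m)) \<partial>forward m) = 1 - singular_prob m)"

definition zero_work :: "'p mixing \<Rightarrow> bool" where
  "zero_work m \<longleftrightarrow> (AE \<omega> in forward m. work m \<omega> = 0)"

text \<open>The events with a counterpart in the forward process are exactly those inside \<open>E\<close>: outside
  \<open>E\<close> the forward process has no paths, and an event inside \<open>E\<close> that is negligible in the forward
  process is negligible in the reversed one.\<close>

definition counterpart_region :: "'p mixing \<Rightarrow> 'p set \<Rightarrow> bool" where
  "counterpart_region m E \<longleftrightarrow>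
     E \<in> sets (forward m) \<and> emeasure (forward m) (space (forward m) - E) = 0 \<and>
     (\<forall>A\<in>sets (forward m). A \<subseteq> E \<longrightarrow> emeasure (forward m) A = 0 \<longrightarrow> emeasure (reversed m) A = 0)"

definition identical_gases :: "nat \<Rightarrow> 'p mixing \<Rightarrow> bool" where
  "identical_gases N m \<longleftrightarrow>
     counterpart_region m {\<omega> \<in> space (forward m). card {i. i < 2 * N \<and> in_left m i \<omega>} = N}"

definition different_gases :: "nat \<Rightarrow> 'p mixing \<Rightarrow> bool" where
  "different_gases N m \<longleftrightarrow>
     counterpart_region m
       {\<omega> \<in> space (forward m). (\<forall>i<N. in_left m i \<omega>) \<and> (\<forall>i\<in>{N..<2 * N}. \<not> in_left m i \<omega>)}"

definition sub_extensive :: "(nat \<Rightarrow> real) \<Rightarrow> bool" where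
  "sub_extensive S \<longleftrightarrow> S \<in> o(\<lambda>N. real N)"

text \<open>In the thermodynamic limit an additive quantity is proportional to the particle number; its
  value is \<open>s\<close> per particle of each gas, and corrections that are not extensive are discarded.\<close>

definition thermodynamic_limit :: "(nat \<Rightarrow> real) \<Rightarrow> real \<Rightarrow> bool" where
  "thermodynamic_limit S s \<longleftrightarrow> (\<lambda>N. S N / real N) \<longlonglongrightarrow> s"

end

theory Submission
  imports Defs "HOL-Real_Asymp.Real_Asymp"
begin

text \<open>The Lebesgue decomposition of the reversed law splits along the counterpart region \<open>E\<close>, so
  \<open>\<lambda>\<^sub>S\<close> is the reversed probability of the complement of \<open>E\<close>. Every left/right pattern of the
  \<open>2 N\<close> independent particles has probability \<open>2\<^bsup>-2N\<^esup>\<close>, so \<open>1 - \<lambda>\<^sub>S\<close> is \<open>2\<^bsup>-2N\<^esup>\<close> times the number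
  of patterns in \<open>E\<close>. As the energy does not change, \<open>\<Delta>F = - T \<Delta>S\<close>, and the Jarzynski equality
  with zero work gives \<open>\<Delta>S\<close>. The asymptotics of the central binomial coefficient come from
  Wallis' product.\<close>

section \<open>Lebesgue decomposition along a counterpart region\<close>

text \<open>Existence half. The part of \<open>Q\<close> on \<open>E\<close> is absolutely
  continuous by \<open>ac\<close>; the part off \<open>E\<close> lives on a set that is null for
  \<open>P\<close>.\<close>

lemma lebesgue_decomposition_restrict:
  assumes sets: "sets Q = sets P" and E: "E \<in> sets P"
    and null: "emeasure P (space P - E) = 0"
    and ac: "\<And>A. A \<in> sets P \<Longrightarrow> A \<subseteq> E \<Longrightarrow> emeasure P A = 0 \<Longrightarrow> emeasure Q A = 0"
  shows "lebesgue_decomposition P Q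
           (density Q (indicator E)) (density Q (indicator (space P - E)))"
proof -
  have EQ: "E \<in> sets Q" "space P - E \<in> sets Q"
    using E sets by auto
  have space: "space Q = space P"
    using sets by (rule sets_eq_imp_space_eq)
  have split: "emeasure Q A = emeasure Q (E \<inter> A) + emeasure Q ((space P - E) \<inter> A)"
    if A: "A \<in> sets Q" for A
  proof -
    have "A = (E \<inter> A) \<union> ((space P - E) \<inter> A)"
      using sets.sets_into_space[OF A] space by auto
    also have "emeasure Q \<dots> = emeasure Q (E \<inter> A) + emeasure Q ((space P - E) \<inter> A)"
      using A EQ by (intro plus_emeasure[symmetric]) auto
    finally show ?thesis .
  qed
  have "absolutely_continuous P (density Q (indicator E))"
    unfolding absolutely_continuous_def
  proof
    fix A assume "A \<in> null_sets P"
    then have A: "A \<in> sets P" "emeasure P A = 0" by auto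
    have "emeasure P (E \<inter> A) \<le> emeasure P A"
      using A by (intro emeasure_mono) auto
    then have "emeasure Q (E \<inter> A) = 0"
      using A E by (intro ac) auto
    then show "A \<in> null_sets (density Q (indicator E))"
      using A EQ sets by (auto simp: null_sets_def emeasure_restricted)
  qed
  moreover have "mutually_singular (density Q (indicator (space P - E))) P"
    unfolding mutually_singular_def
  \<comment> \<open>The separating set is the complement of \<open>E\<close>: it carries the whole
    restricted measure, and \<open>P\<close> does not charge it.\<close>
  proof (intro conjI bexI[of _ "space P - E"])
    have "(space P - E) \<inter> (space P - (space P - E)) = {}" by auto
    then show "emeasure (density Q (indicator (space P - E))) (space P - (space P - E)) = 0"
      using E EQ sets by (subst emeasure_restricted) auto
  qed (use E sets null in auto)
  moreover have "\<forall>A\<in>sets Q. emeasure Q A =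
      emeasure (density Q (indicator E)) A + emeasure (density Q (indicator (space P - E))) A"
  proof
    fix A assume A: "A \<in> sets Q"
    show "emeasure Q A =
        emeasure (density Q (indicator E)) A + emeasure (density Q (indicator (space P - E))) A"
      unfolding emeasure_restricted[OF EQ(1) A] emeasure_restricted[OF EQ(2) A]
      by (rule split[OF A])
  qed
  ultimately show ?thesis
    by (simp add: lebesgue_decomposition_def)
qed

text \<open>Uniqueness half. For any decomposition, \<open>Qs\<close> vanishes on \<open>E\<close>
  and \<open>Qac\<close> vanishes off \<open>E\<close>, so all the mass of \<open>Qs\<close> is what
  \<open>Q\<close> puts off \<open>E\<close>.\<close>

lemma lebesgue_decomposition_singular_mass:
  assumes dec: "lebesgue_decomposition P Q Qac Qs"
    and sets: "sets Q = sets P" and E: "E \<in> sets P"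
    and null: "emeasure P (space P - E) = 0"
    and ac: "\<And>A. A \<in> sets P \<Longrightarrow> A \<subseteq> E \<Longrightarrow> emeasure P A = 0 \<Longrightarrow> emeasure Q A = 0"
  shows "measure Qs (space Qs) = measure Q (space P - E)"
proof -
  have setss: "sets Qs = sets P" and acc: "absolutely_continuous P Qac"
    and add: "\<And>A. A \<in> sets P \<Longrightarrow> emeasure Q A = emeasure Qac A + emeasure Qs A"
    using dec sets by (auto simp: lebesgue_decomposition_def)
  have space: "space Qs = space P"
    using setss by (rule sets_eq_imp_space_eq)
  obtain B where B: "B \<in> sets P" "emeasure Qs (space P - B) = 0" "emeasure P B = 0"
    using dec by (auto simp: lebesgue_decomposition_def mutually_singular_def)
  \<comment> \<open>\<open>B\<close> carries \<open>Qs\<close> and is null for \<open>P\<close>, so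
    \<open>ac\<close> applies to \<open>E \<inter> B\<close>. Since \<open>Qs\<close> is dominated
    by \<open>Q\<close>, it vanishes there too, and the rest of \<open>E\<close> lies outside
    \<open>B\<close>.\<close>
  have "emeasure P (E \<inter> B) \<le> emeasure P B"
    using B by (intro emeasure_mono) auto
  then have "emeasure Q (E \<inter> B) = 0"
    using B E by (intro ac) auto
  then have "emeasure Qs (E \<inter> B) = 0"
    using add[of "E \<inter> B"] B E by auto
  then have "emeasure Qs ((E \<inter> B) \<union> (space P - B)) = 0"
    using B E setss by (subst emeasure_Un_null_set) (auto simp: null_sets_def)
  moreover have "emeasure Qs E \<le> emeasure Qs ((E \<inter> B) \<union> (space P - B))"
    using B E setss sets.sets_into_space[OF E] by (intro emeasure_mono) auto
  ultimately have Qs_E: "emeasure Qs E = 0" by simp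
  have "emeasure Qs (space P) = emeasure Qs ((space P - E) \<union> E)"
    using sets.sets_into_space[OF E] by (simp add: Un_absorb2)
  also have "\<dots> = emeasure Qs (space P - E)"
    using Qs_E E setss by (intro emeasure_Un_null_set) (auto simp: null_sets_def)
  \<comment> \<open>Off \<open>E\<close> the summand \<open>Qac\<close> is zero, because
    \<open>P\<close> is zero there.\<close>
  also have "\<dots> = emeasure Q (space P - E)"
    using add[of "space P - E"] absolutely_continuousD[OF acc _ null] E by auto
  finally show ?thesis
    by (simp add: measure_def space)
qed

text \<open>The two halves together show that the definite description denotes, and they give its
  value.\<close>

lemma singular_probability_eq:
  assumes "sets Q = sets P" "E \<in> sets P" "emeasure P (space P - E) = 0"
    and "\<And>A. A \<in> sets P \<Longrightarrow> A \<subseteq> E \<Longrightarrow> emeasure P A = 0 \<Longrightarrow> emeasure Q A = 0"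
  shows "singular_probability P Q = measure Q (space P - E)"
  unfolding singular_probability_def
proof (rule the_equality)
  have dec: "lebesgue_decomposition P Q
      (density Q (indicator E)) (density Q (indicator (space P - E)))"
    using assms by (rule lebesgue_decomposition_restrict)
  show "\<exists>Qac Qs. lebesgue_decomposition P Q Qac Qs \<and>
      measure Q (space P - E) = measure Qs (space Qs)"
    using dec lebesgue_decomposition_singular_mass[OF dec assms] by metis
qed (use lebesgue_decomposition_singular_mass[OF _ assms] in blast)

section \<open>Independent fair two-valued variables\<close>

text \<open>A pattern prescribes one value per index. Both values have probability 1/2, the value
  \<open>False\<close> by complement, and independence multiplies these factors.\<close>

lemma (in prob_space) prob_fair_pattern:
  assumes ind: "indep_vars (\<lambda>_. count_space UNIV) X I" and "finite I"
    and half: "\<And>i. i \<in> I \<Longrightarrow> prob {\<omega> \<in> space M. X i \<omega>} = 1 / 2"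
  shows "{\<omega> \<in> space M. \<forall>i\<in>I. X i \<omega> \<longleftrightarrow> i \<in> S} \<in> events"
    and "prob {\<omega> \<in> space M. \<forall>i\<in>I. X i \<omega> \<longleftrightarrow> i \<in> S} = (1 / 2) ^ card I"
proof -
  have rv: "X i \<in> measurable M (count_space UNIV)" if "i \<in> I" for i
    using ind that by (auto simp: indep_vars_def)
  have ev: "X i -` {b} \<inter> space M \<in> events" if "i \<in> I" for i b
    using rv[OF that] by (rule measurable_sets) simp
  have half': "prob (X i -` {b} \<inter> space M) = 1 / 2" if i: "i \<in> I" for i b
  proof -
    have "X i -` {True} \<inter> space M = {\<omega> \<in> space M. X i \<omega>}" by auto
    then have t: "prob (X i -` {True} \<inter> space M) = 1 / 2"
      using half[OF i] by simp
    have "X i -` {False} \<inter> space M = space M - (X i -` {True} \<inter> space M)" by auto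
    then have "prob (X i -` {False} \<inter> space M) = 1 / 2"
      using t prob_compl[OF ev[OF i]] by simp
    with t show ?thesis by (cases b) auto
  qed
  have "prob {\<omega> \<in> space M. \<forall>i\<in>I. X i \<omega> \<longleftrightarrow> i \<in> S} = (1 / 2) ^ card I \<and>
      {\<omega> \<in> space M. \<forall>i\<in>I. X i \<omega> \<longleftrightarrow> i \<in> S} \<in> events"
  \<comment> \<open>The empty pattern is the whole space. It is treated apart because the product
    rule and the intersection of events are applied to a nonempty index set.\<close>
  proof (cases "I = {}")
    case True
    then show ?thesis by (simp add: prob_space)
  next
    case False
    then have eq: "{\<omega> \<in> space M. \<forall>i\<in>I. X i \<omega> \<longleftrightarrow> i \<in> S} =
        (\<Inter>i\<in>I. X i -` {i \<in> S} \<inter> space M)" by auto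
    have "prob (\<Inter>i\<in>I. X i -` {i \<in> S} \<inter> space M) = (\<Prod>i\<in>I. prob (X i -` {i \<in> S} \<inter> space M))"
      using ind False \<open>finite I\<close> by (rule indep_varsD_finite) simp
    moreover have "(\<Inter>i\<in>I. X i -` {i \<in> S} \<inter> space M) \<in> events"
      using False \<open>finite I\<close> ev by (intro sets.finite_INT) auto
    ultimately show ?thesis
      unfolding eq by (simp add: half')
  qed
  then show "{\<omega> \<in> space M. \<forall>i\<in>I. X i \<omega> \<longleftrightarrow> i \<in> S} \<in> events"
    and "prob {\<omega> \<in> space M. \<forall>i\<in>I. X i \<omega> \<longleftrightarrow> i \<in> S} = (1 / 2) ^ card I"
    by auto
qed

text \<open>The set \<open>S\<close> of indices where \<open>X\<close> is true splits the event into
  disjoint patterns, one for each \<open>k\<close>-element subset of \<open>I\<close>, all equally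
  likely.\<close>

lemma (in prob_space) prob_fair_count:
  assumes ind: "indep_vars (\<lambda>_. count_space UNIV) X I" and fin: "finite I"
    and half: "\<And>i. i \<in> I \<Longrightarrow> prob {\<omega> \<in> space M. X i \<omega>} = 1 / 2"
  shows "prob {\<omega> \<in> space M. card {i\<in>I. X i \<omega>} = k} = real (card I choose k) / 2 ^ card I"
proof -
  let ?C = "\<lambda>S. {\<omega> \<in> space M. \<forall>i\<in>I. X i \<omega> \<longleftrightarrow> i \<in> S}"
  let ?K = "{S. S \<subseteq> I \<and> card S = k}"
  have "{\<omega> \<in> space M. card {i\<in>I. X i \<omega>} = k} = (\<Union>S\<in>?K. ?C S)"
  proof (intro equalityI subsetI)
    fix \<omega> assume "\<omega> \<in> {\<omega> \<in> space M. card {i\<in>I. X i \<omega>} = k}"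
    then show "\<omega> \<in> (\<Union>S\<in>?K. ?C S)"
      by (intro UN_I[of "{i\<in>I. X i \<omega>}"]) auto
  next
    fix \<omega> assume "\<omega> \<in> (\<Union>S\<in>?K. ?C S)"
    then obtain S where S: "S \<subseteq> I" "card S = k" "\<omega> \<in> ?C S" by auto
    then have "{i\<in>I. X i \<omega>} = S" by auto
    with S show "\<omega> \<in> {\<omega> \<in> space M. card {i\<in>I. X i \<omega>} = k}" by auto
  qed
  also have "prob \<dots> = (\<Sum>S\<in>?K. prob (?C S))"
  proof (rule finite_measure_finite_Union)
    show "finite ?K" using fin by auto
    show "?C ` ?K \<subseteq> events"
      using prob_fair_pattern(1)[OF ind fin half] by blast
    show "disjoint_family_on ?C ?K"
      unfolding disjoint_family_on_def by blast
  qed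
  also have "\<dots> = real (card ?K) * (1 / 2) ^ card I"
    using prob_fair_pattern(2)[OF ind fin half] by simp
  finally show ?thesis
    by (simp add: n_subsets[OF fin] power_one_over)
qed

section \<open>Singular probability and entropy production of the mixing\<close>

context ideal_gas_mixing
begin

lemma singular_prob_eq:
  assumes "counterpart_region m E"
  shows "singular_prob m = 1 - measure (reversed m) E"
proof -
  interpret R: prob_space "reversed m" by (rule prob_space_reversed)
  have E: "E \<in> sets (forward m)"
    using assms by (simp add: counterpart_region_def)
  have "singular_prob m = measure (reversed m) (space (forward m) - E)"
    using assms unfolding singular_prob_def counterpart_region_def
    by (intro singular_probability_eq sets_reversed) auto
  also have "space (forward m) = space (reversed m)"
    using sets_reversed by (rule sets_eq_imp_space_eq[symmetric])
  also have "measure (reversed m) (space (reversed m) - E) = 1 - measure (reversed m) E"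
    using E sets_reversed by (intro R.prob_compl) simp
  finally show ?thesis .
qed

lemma singular_prob_identical:
  assumes "identical_gases N m"
  shows "singular_prob m = 1 - real ((2 * N) choose N) / 2 ^ (2 * N)"
proof -
  interpret R: prob_space "reversed m" by (rule prob_space_reversed)
  let ?E = "{\<omega> \<in> space (forward m). card {i. i < 2 * N \<and> in_left m i \<omega>} = N}"
  have space: "space (forward m) = space (reversed m)"
    using sets_reversed by (rule sets_eq_imp_space_eq[symmetric])
  have "?E = {\<omega> \<in> space (reversed m). card {i\<in>{..<2 * N}. in_left m i \<omega>} = N}"
    unfolding space by simp
  also have "measure (reversed m) \<dots> = real (card {..<2 * N} choose N) / 2 ^ card {..<2 * N}"
    by (rule R.prob_fair_count[OF independent_particles]) (simp_all add: half_probability)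
  finally have "measure (reversed m) ?E = real ((2 * N) choose N) / 2 ^ (2 * N)"
    by (simp only: card_lessThan)
  then show ?thesis
    using singular_prob_eq[OF assms[unfolded identical_gases_def]] by (simp only:)
qed

lemma singular_prob_different:
  assumes "different_gases N m"
  shows "singular_prob m = 1 - 1 / 2 ^ (2 * N)"
proof -
  interpret R: prob_space "reversed m" by (rule prob_space_reversed)
  have space: "space (forward m) = space (reversed m)"
    using sets_reversed by (rule sets_eq_imp_space_eq[symmetric])
  let ?E = "{\<omega> \<in> space (forward m).
    (\<forall>i<N. in_left m i \<omega>) \<and> (\<forall>i\<in>{N..<2 * N}. \<not> in_left m i \<omega>)}"
  \<comment> \<open>For different gases the region is a single pattern, the one with
    \<open>S = {..<N}\<close>.\<close>
  have "((\<forall>i<N. in_left m i \<omega>) \<and> (\<forall>i\<in>{N..<2 * N}. \<not> in_left m i \<omega>)) \<longleftrightarrow>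
      (\<forall>i\<in>{..<2 * N}. in_left m i \<omega> \<longleftrightarrow> i \<in> {..<N})" for \<omega>
    by (auto simp: not_less)
  then have "?E = {\<omega> \<in> space (reversed m). \<forall>i\<in>{..<2 * N}. in_left m i \<omega> \<longleftrightarrow> i \<in> {..<N}}"
    unfolding space by (simp only:)
  also have "measure (reversed m) \<dots> = (1 / 2) ^ card {..<2 * N}"
    by (rule R.prob_fair_pattern(2)[OF independent_particles]) (simp_all add: half_probability)
  finally have "measure (reversed m) ?E = 1 / 2 ^ (2 * N)"
    by (simp only: card_lessThan power_one_over)
  then show ?thesis
    using singular_prob_eq[OF assms[unfolded different_gases_def]] by (simp only:)
qed

text \<open>The energy terms cancel by \<open>ideal_gas_energy\<close>, which leaves only the
  entropic part of each Helmholtz energy.\<close>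

lemma free_energy_diff_eq: "free_energy_diff T m = - T * entropy_production m"
  using ideal_gas_energy
  by (simp add: free_energy_diff_def helmholtz_def entropy_production_def algebra_simps)

text \<open>With zero work almost everywhere the integrand is a constant, so
  \<open>1 - singular_prob m\<close> equals an exponential. It is therefore positive, and its
  logarithm recovers the exponent.\<close>

lemma free_energy_diff_jarzynski:
  assumes "0 < kB" "0 < T" "jarzynski_equality kB T m" "zero_work m"
  shows "free_energy_diff T m = kB * T * ln (1 - singular_prob m)"
proof -
  interpret F: prob_space "forward m" by (rule prob_space_forward)
  note work_measurable [measurable]
  have "(\<integral>\<omega>. exp (- (1 / (kB * T)) * (work m \<omega> - free_energy_diff T m)) \<partial>forward m) =
      (\<integral>\<omega>. exp (free_energy_diff T m / (kB * T)) \<partial>forward m)"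
    using assms(4) unfolding zero_work_def
    by (intro integral_cong_AE) (measurable, auto elim!: eventually_mono)
  also have "\<dots> = exp (free_energy_diff T m / (kB * T))"
    by (simp add: F.prob_space)
  finally have "1 - singular_prob m = exp (free_energy_diff T m / (kB * T))"
    using assms(3) by (simp add: jarzynski_equality_def Let_def)
  then show ?thesis
    using assms by simp
qed

lemma entropy_production_jarzynski:
  assumes "0 < kB" "0 < T" "jarzynski_equality kB T m" "zero_work m"
  shows "entropy_production m = - kB * ln (1 - singular_prob m)"
proof -
  have "T * entropy_production m = T * (- kB * ln (1 - singular_prob m))"
    using free_energy_diff_jarzynski[OF assms] by (simp add: free_energy_diff_eq algebra_simps)
  then show ?thesis
    using assms(2) by (metis mult_left_cancel less_irrefl)
qed

lemma entropy_production_identical: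
  assumes "0 < kB" "0 < T" "jarzynski_equality kB T m" "zero_work m" "identical_gases N m"
  shows "entropy_production m = 2 * real N * kB * ln 2 - kB * ln (real ((2 * N) choose N))"
proof -
  have "entropy_production m = - kB * (ln (real ((2 * N) choose N)) - real (2 * N) * ln 2)"
    unfolding entropy_production_jarzynski[OF assms(1-4)] singular_prob_identical[OF assms(5)]
    by (simp add: ln_div ln_realpow)
  then show ?thesis
    by (simp add: right_diff_distrib)
qed

lemma entropy_production_different:
  assumes "0 < kB" "0 < T" "jarzynski_equality kB T m" "zero_work m" "different_gases N m"
  shows "entropy_production m = 2 * real N * kB * ln 2"
proof -
  have "entropy_production m = - kB * (ln 1 - real (2 * N) * ln 2)"
    unfolding entropy_production_jarzynski[OF assms(1-4)] singular_prob_different[OF assms(5)]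
    by (simp add: ln_div ln_realpow)
  then show ?thesis
    by (simp add: right_diff_distrib)
qed

end

section \<open>Central binomial coefficients and Wallis' product\<close>

text \<open>The factor \<open>2 * real n + 1\<close> makes the identity exact: passing from
  \<open>n\<close> to \<open>Suc n\<close> multiplies the left side by (2n+1)(2n+3)/(4(n+1)^2), the
  inverse of the next Wallis factor.\<close>

lemma central_binomial_wallis:
  "(real ((2 * n) choose n) / 2 ^ (2 * n))\<^sup>2 * (2 * real n + 1) =
     inverse (\<Prod>k=1..n. (4 * real k ^ 2) / (4 * real k ^ 2 - 1))"
proof (induction n)
  case 0
  then show ?case by simp
next
  case (Suc n)
  define c where "c = real ((2 * n) choose n) / 2 ^ (2 * n)"
  have sym: "(2 * n + 1) choose Suc n = (2 * n + 1) choose n"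
    using binomial_symmetric[of n "2 * n + 1"] by simp
  \<comment> \<open>Pascal's rule gives the two middle entries of row 2n+1, which agree by
    symmetry.\<close>
  have 1: "real ((2 * Suc n) choose Suc n) = 2 * real ((2 * n + 1) choose n)"
    using binomial_Suc_Suc[of "2 * n + 1" n] sym by simp
  \<comment> \<open>The absorption identity, which lowers the row from 2n+1 to 2n.\<close>
  have "real (Suc n) * real ((2 * n + 1) choose Suc n) = real (2 * n + 1) * real ((2 * n) choose n)"
    using arg_cong[OF Suc_times_binomial_eq[of "2 * n" n], of real]
    by (simp only: of_nat_mult) (simp add: algebra_simps)
  then have 2: "real ((2 * n + 1) choose n) = (2 * real n + 1) / (real n + 1) * real ((2 * n) choose n)"
    unfolding sym by (simp add: field_simps)
  have step: "real ((2 * Suc n) choose Suc n) / 2 ^ (2 * Suc n) = (2 * real n + 1) / (2 * real (Suc n)) * c"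
    unfolding 1 2 c_def by (simp add: divide_simps)
  have "((2 * real n + 1) / (2 * real (Suc n)) * c)\<^sup>2 * (2 * real (Suc n) + 1) =
      (c\<^sup>2 * (2 * real n + 1)) * inverse ((4 * real (Suc n) ^ 2) / (4 * real (Suc n) ^ 2 - 1))"
  proof -
    have "4 * real (Suc n) ^ 2 - 1 = (2 * real n + 1) * (2 * real (Suc n) + 1)"
      by (simp add: power2_eq_square algebra_simps)
    \<comment> \<open>Used with a = 2n+1, b = n+1, d = 2n+3. The convention x/0 = 0 makes it valid
      for all reals.\<close>
    moreover have "(a / (2 * b) * c)\<^sup>2 * d = (c\<^sup>2 * a) * inverse ((4 * b\<^sup>2) / (a * d))" for a b d :: real
      by (simp add: power2_eq_square)
    ultimately show ?thesis
      by (simp only:)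
  qed
  also have "\<dots> = inverse (\<Prod>k=1..Suc n. (4 * real k ^ 2) / (4 * real k ^ 2 - 1))"
    unfolding Suc.IH[folded c_def] inverse_mult_distrib[symmetric]
    by (simp only: prod.nat_ivl_Suc' le_add1 plus_1_eq_Suc mult.commute)
  finally show ?case
    by (simp only: step)
qed

text \<open>This is the square of the asymptotics 4^n / sqrt(pi n) of the central binomial
  coefficient. Wallis' product tends to pi/2, and the weight 2n+1 is then exchanged for pi
  n.\<close>

lemma central_binomial_tendsto:
  "(\<lambda>n. (real ((2 * n) choose n) / 2 ^ (2 * n))\<^sup>2 * (pi * real n)) \<longlonglongrightarrow> 1"
proof -
  have "(\<lambda>n. (real ((2 * n) choose n) / 2 ^ (2 * n))\<^sup>2 * (2 * real n + 1)) \<longlonglongrightarrow> inverse (pi / 2)"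
    unfolding central_binomial_wallis by (intro tendsto_inverse wallis) simp
  moreover have "(\<lambda>n. pi * real n / (2 * real n + 1)) \<longlonglongrightarrow> pi / 2"
    by real_asymp
  ultimately have "(\<lambda>n. (real ((2 * n) choose n) / 2 ^ (2 * n))\<^sup>2 * (2 * real n + 1) *
      (pi * real n / (2 * real n + 1))) \<longlonglongrightarrow> inverse (pi / 2) * (pi / 2)"
    by (rule tendsto_mult)
  moreover have "a * (2 * real n + 1) * (pi * real n / (2 * real n + 1)) = a * (pi * real n)" for a n
    by (simp add: add_nonneg_eq_0_iff)
  ultimately show ?thesis by simp
qed

text \<open>Minus one half of the logarithm of the previous limit.\<close>

lemma ln_central_binomial_tendsto:
  "(\<lambda>n. 2 * real n * ln 2 - ln (real ((2 * n) choose n)) - 1 / 2 * ln (pi * real n)) \<longlonglongrightarrow> 0"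
proof -
  have "(\<lambda>n. - (1 / 2) * ln ((real ((2 * n) choose n) / 2 ^ (2 * n))\<^sup>2 * (pi * real n))) \<longlonglongrightarrow>
      - (1 / 2) * ln 1"
    by (intro tendsto_intros central_binomial_tendsto) simp
  then have lim: "(\<lambda>n. - (1 / 2) * ln ((real ((2 * n) choose n) / 2 ^ (2 * n))\<^sup>2 * (pi * real n)))
      \<longlonglongrightarrow> 0" by simp
  show ?thesis
  proof (rule Lim_transform_eventually[OF lim])
    show "\<forall>\<^sub>F n in sequentially.
        - (1 / 2) * ln ((real ((2 * n) choose n) / 2 ^ (2 * n))\<^sup>2 * (pi * real n)) =
        2 * real n * ln 2 - ln (real ((2 * n) choose n)) - 1 / 2 * ln (pi * real n)"
      \<comment> \<open>For positive \<open>n\<close> both factors are positive, so the logarithm of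
        the product splits.\<close>
      using eventually_gt_at_top[of 0]
    proof eventually_elim
      case (elim n)
      define c where "c = real ((2 * n) choose n)"
      have "0 < c" unfolding c_def by simp
      have "ln ((c / 2 ^ (2 * n))\<^sup>2 * (pi * real n)) =
          2 * (ln c - real (2 * n) * ln 2) + ln (pi * real n)"
        using \<open>0 < c\<close> elim by (subst ln_mult_pos) (simp_all add: ln_realpow ln_div)
      then show ?case
        unfolding c_def[symmetric] by (simp add: field_simps)
    qed
  qed
qed

section \<open>From a vanishing error to asymptotic equivalence and sub-extensivity\<close>

text \<open>The main term \<open>c * ln (pi * real N)\<close> tends to infinity but is small against
  \<open>N\<close>. A vanishing error thus disappears after division by either one.\<close>

lemma entropy_asymptotics:
  fixes S :: "nat \<Rightarrow> real"
  assumes "0 < c" and lim: "(\<lambda>N. S N - c * ln (pi * real N)) \<longlonglongrightarrow> 0"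
  shows "S \<sim>[sequentially] (\<lambda>N. c * ln (pi * real N))"
    and "thermodynamic_limit S 0"
    and "sub_extensive S"
proof -
  have "filterlim (\<lambda>N. c * ln (pi * real N)) at_top sequentially"
    using \<open>0 < c\<close> by real_asymp
  then have top: "filterlim (\<lambda>N. c * ln (pi * real N)) at_infinity sequentially"
    and ne: "\<forall>\<^sub>F N in sequentially. c * ln (pi * real N) \<noteq> 0"
    by (auto intro: filterlim_at_top_imp_at_infinity
        eventually_mono[OF filterlim_at_top_dense[THEN iffD1, rule_format, of _ _ 0]])
  \<comment> \<open>The quotient of \<open>S N\<close> by the main term is 1 plus the relative
    error, once the main term is nonzero.\<close>
  have "(\<lambda>N. (S N - c * ln (pi * real N)) / (c * ln (pi * real N)) + 1) \<longlonglongrightarrow> 0 + 1"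
    by (intro tendsto_add tendsto_const tendsto_divide_0[OF lim top])
  moreover have "\<forall>\<^sub>F N in sequentially. (S N - c * ln (pi * real N)) / (c * ln (pi * real N)) + 1 =
      S N / (c * ln (pi * real N))"
    using ne by eventually_elim (simp add: diff_divide_distrib)
  ultimately have "(\<lambda>N. S N / (c * ln (pi * real N))) \<longlonglongrightarrow> 0 + 1"
    by (rule Lim_transform_eventually)
  then show "S \<sim>[sequentially] (\<lambda>N. c * ln (pi * real N))"
    by (intro asymp_equivI') simp
  have "filterlim real at_infinity sequentially"
    by (rule tendsto_of_nat)
  then have "(\<lambda>N. (S N - c * ln (pi * real N)) / real N) \<longlonglongrightarrow> 0"
    by (rule tendsto_divide_0[OF lim])
  moreover have "(\<lambda>N. c * ln (pi * real N) / real N) \<longlonglongrightarrow> 0"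
    by real_asymp
  ultimately have "(\<lambda>N. (S N - c * ln (pi * real N)) / real N + c * ln (pi * real N) / real N)
      \<longlonglongrightarrow> 0 + 0"
    by (rule tendsto_add)
  then have S0: "(\<lambda>N. S N / real N) \<longlonglongrightarrow> 0"
    by (simp add: diff_divide_distrib)
  then show "thermodynamic_limit S 0"
    by (simp add: thermodynamic_limit_def)
  show "sub_extensive S"
    unfolding sub_extensive_def
    by (rule smalloI_tendsto[OF S0]) (use eventually_gt_at_top[of 0] in \<open>auto elim: eventually_mono\<close>)
qed


text \<open>The large-\<open>N\<close> claims concern a family with one mixing for each positive
  \<open>N\<close>. The approximation is stated both as a difference tending to 0 and as asymptotic
  equivalence.\<close>

theorem mainTheorem8:
  fixes kB T :: real
  assumes "0 < kB" and "0 < T"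
  shows
    "(\<forall>N (m :: 'p mixing).
        ideal_gas_mixing N m \<and> jarzynski_equality kB T m \<and> zero_work m \<longrightarrow>
          free_energy_diff T m = kB * T * ln (1 - singular_prob m) \<and>
          entropy_production m = - kB * ln (1 - singular_prob m)) \<and>
     (\<forall>N (m :: 'p mixing). ideal_gas_mixing N m \<and> identical_gases N m \<longrightarrow>
        singular_prob m = 1 - real ((2 * N) choose N) / 2 ^ (2 * N) \<and>
        (jarzynski_equality kB T m \<and> zero_work m \<longrightarrow>
          entropy_production m
            = 2 * real N * kB * ln 2 - kB * ln (real ((2 * N) choose N)))) \<and>
     (\<forall>m :: nat \<Rightarrow> 'p mixing.
        (\<forall>N>0. ideal_gas_mixing N (m N) \<and> identical_gases N (m N) \<and>
                jarzynski_equality kB T (m N) \<and> zero_work (m N)) \<longrightarrow>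
        (\<lambda>N. entropy_production (m N) - 1 / 2 * kB * ln (pi * real N)) \<longlonglongrightarrow> 0 \<and>
        (\<lambda>N. entropy_production (m N)) \<sim>[sequentially] (\<lambda>N. 1 / 2 * kB * ln (pi * real N)) \<and>
        sub_extensive (\<lambda>N. entropy_production (m N)) \<and>
        thermodynamic_limit (\<lambda>N. entropy_production (m N)) 0) \<and>
     (\<forall>N (m :: 'p mixing). ideal_gas_mixing N m \<and> different_gases N m \<longrightarrow>
        singular_prob m = 1 - 1 / 2 ^ (2 * N) \<and>
        (jarzynski_equality kB T m \<and> zero_work m \<longrightarrow>
          entropy_production m = 2 * real N * kB * ln 2))"
proof (intro conjI allI impI; (elim conjE)?)
  fix m :: "nat \<Rightarrow> 'p mixing"
  assume *: "\<forall>N>0. ideal_gas_mixing N (m N) \<and> identical_gases N (m N) \<and>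
      jarzynski_equality kB T (m N) \<and> zero_work (m N)"
  have "(\<lambda>N. kB * (2 * real N * ln 2 - ln (real ((2 * N) choose N)) - 1 / 2 * ln (pi * real N)))
      \<longlonglongrightarrow> kB * 0"
    by (intro tendsto_mult tendsto_const ln_central_binomial_tendsto)
  moreover have "\<forall>\<^sub>F N in sequentially.
      kB * (2 * real N * ln 2 - ln (real ((2 * N) choose N)) - 1 / 2 * ln (pi * real N)) =
      entropy_production (m N) - 1 / 2 * kB * ln (pi * real N)"
    \<comment> \<open>Nothing is assumed of \<open>m 0\<close>, so the exact formula for the entropy
      is available only for positive \<open>N\<close>.\<close>
    using eventually_gt_at_top[of 0]
  proof eventually_elim
    case (elim N)
    then have "entropy_production (m N) =
        2 * real N * kB * ln 2 - kB * ln (real ((2 * N) choose N))"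
      using * assms by (intro ideal_gas_mixing.entropy_production_identical[where T = T]) auto
    then show ?case
      by (simp add: right_diff_distrib)
  qed
  ultimately have "(\<lambda>N. entropy_production (m N) - 1 / 2 * kB * ln (pi * real N)) \<longlonglongrightarrow> kB * 0"
    by (rule Lim_transform_eventually)
  then show lim: "(\<lambda>N. entropy_production (m N) - 1 / 2 * kB * ln (pi * real N)) \<longlonglongrightarrow> 0"
    by simp
  have "0 < 1 / 2 * kB" using assms by simp
  note asymp = entropy_asymptotics[OF this lim]
  show "(\<lambda>N. entropy_production (m N)) \<sim>[sequentially] (\<lambda>N. 1 / 2 * kB * ln (pi * real N))"
    by (rule asymp(1))
  show "thermodynamic_limit (\<lambda>N. entropy_production (m N)) 0"
    by (rule asymp(2))
  show "sub_extensive (\<lambda>N. entropy_production (m N))"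
    by (rule asymp(3))
next
  fix N and m :: "'p mixing"
  assume gas: "ideal_gas_mixing N m"
  interpret ideal_gas_mixing N m by (rule gas)
  {
    assume jar: "jarzynski_equality kB T m" "zero_work m"
    show "free_energy_diff T m = kB * T * ln (1 - singular_prob m)"
      by (rule free_energy_diff_jarzynski[OF assms jar])
    show "entropy_production m = - kB * ln (1 - singular_prob m)"
      by (rule entropy_production_jarzynski[OF assms jar])
    show "entropy_production m = 2 * real N * kB * ln 2 - kB * ln (real ((2 * N) choose N))"
      if "identical_gases N m"
      by (rule entropy_production_identical[OF assms jar that])
    show "entropy_production m = 2 * real N * kB * ln 2" if "different_gases N m"
      by (rule entropy_production_different[OF assms jar that])
  }
  show "singular_prob m = 1 - real ((2 * N) choose N) / 2 ^ (2 * N)" if "identical_gases N m"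
    by (rule singular_prob_identical[OF that])
  show "singular_prob m = 1 - 1 / 2 ^ (2 * N)" if "different_gases N m"
    by (rule singular_prob_different[OF that])
qed

end
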